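(* Let $U$ be an open subset of $\{(t,x,y,z)\in\mathbb{R}^4: x>0\}$ with the Riemannian metric $g=dt^2+dx^2+x\,dy^2+x^2\,dz^2$. Then: - the Weyl tensor of $g$ has type B at every point; - the eigenflag directions of the Weyl tensor are spanned by the coordinate vector fields $\partial_t,\partial_x,\partial_y,\partial_z$; - the functions $t,y,z$ are limiting Carleman weights; - the function $x$ is not a limiting Carleman weight.
   Context: View the Weyl tensor at $q$ as a symmetric operator $W_q$ on $\Lambda^2T_qU$. An eigenflag direction of $W_q$ is a line $\langle v\rangle$, $0\ne v\in T_qU$, with $W_q(v\wedge v^\perp)\subset v\wedge v^\perp$, where $v\wedge v^\perp=\{v\wedge w:w\perp v\}$. $W_q$ has type B if it has at least one eigenflag direction and three different eigenspaces of dimension $2$ (it then has exactly four eigenflag directions). Limiting Carleman weight: a smooth function $\varphi:V\to\mathbb{R}$ on an open Riemannian manifold $(V,g)$ with nowhere vanishing gradient such that for every $q\in V$ and every $\xi\in T_qV$ with $g(\xi,\nabla\varphi)=0$ and $|\xi|_g=|\nabla\varphi|_g$ one has $\nabla^2\varphi(\nabla\varphi,\nabla\varphi)+\nabla^2\varphi(\xi,\xi)=0$. Equivalently, $d\varphi$ is nowhere zero and the gradient of $\varphi$ with respect to $\tilde g=|\nabla\varphi|_g^2\,g$ is a (unit) parallel vector field for $\tilde g$. The set $U$ is understood to be nonempty. *)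

theory Defs
  imports "HOL-Analysis.Analysis"
begin

text \<open>
  Riemannian geometry in a global coordinate chart. Points and tangent vectors both have
  type \<^typ>\<open>real^'n\<close>, the \<open>i\<close>-th coordinate vector field being \<open>axis i 1\<close>. A metric on an
  open set is given by its Gram matrix field; its values outside the open set play no role, since
  all notions below depend only on the germ of their arguments at the point considered.
\<close>

definition partial :: "'n::finite \<Rightarrow> (real^'n \<Rightarrow> real) \<Rightarrow> real^'n \<Rightarrow> real" where
  "partial i f q = deriv (\<lambda>s. f (q + s *\<^sub>R axis i 1)) 0"

primrec Ck_on :: "nat \<Rightarrow> (real^'n::finite) set \<Rightarrow> (real^'n \<Rightarrow> real) \<Rightarrow> bool" where
  "Ck_on 0 S f \<longleftrightarrow> continuous_on S f"
| "Ck_on (Suc k) S f \<longleftrightarrow> f differentiable_on S \<and> (\<forall>i. Ck_on k S (partial i f))"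

text \<open>Intended for open \<open>S\<close> only.\<close>

definition smooth_on :: "(real^'n::finite) set \<Rightarrow> (real^'n \<Rightarrow> real) \<Rightarrow> bool" where
  "smooth_on S f \<longleftrightarrow> (\<forall>k. Ck_on k S f)"

type_synonym 'n metric = "real^'n \<Rightarrow> real^'n^'n"

definition riemannian_metric_on :: "(real^'n::finite) set \<Rightarrow> 'n metric \<Rightarrow> bool" where
  "riemannian_metric_on U g \<longleftrightarrow>
     (\<forall>i j. smooth_on U (\<lambda>q. g q $ i $ j)) \<and>
     (\<forall>q\<in>U. transpose (g q) = g q \<and> (\<forall>v. v \<noteq> 0 \<longrightarrow> v \<bullet> (g q *v v) > 0))"

definition ginner :: "real^'n^'n \<Rightarrow> real^'n \<Rightarrow> real^'n::finite \<Rightarrow> real" where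
  "ginner G v w = v \<bullet> (G *v w)"

definition gnorm :: "real^'n^'n \<Rightarrow> real^'n::finite \<Rightarrow> real" where
  "gnorm G v = sqrt (ginner G v v)"


text \<open>The Levi-Civita connection: \<open>christoffel g k i j q\<close> is $\Gamma^k_{ij}(q)$.\<close>

definition christoffel :: "'n metric \<Rightarrow> 'n \<Rightarrow> 'n \<Rightarrow> 'n \<Rightarrow> real^'n::finite \<Rightarrow> real" where
  "christoffel g k i j q =
     (\<Sum>l\<in>UNIV. matrix_inv (g q) $ k $ l *
        (partial i (\<lambda>p. g p $ j $ l) q + partial j (\<lambda>p. g p $ i $ l) q
         - partial l (\<lambda>p. g p $ i $ j) q)) / 2"

definition gradient :: "'n metric \<Rightarrow> (real^'n \<Rightarrow> real) \<Rightarrow> real^'n::finite \<Rightarrow> real^'n" where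
  "gradient g f q = matrix_inv (g q) *v (\<chi> i. partial i f q)"

definition hessian :: "'n metric \<Rightarrow> (real^'n \<Rightarrow> real) \<Rightarrow> real^'n::finite \<Rightarrow> real^'n \<Rightarrow> real^'n \<Rightarrow> real" where
  "hessian g f q v w =
     (\<Sum>i\<in>UNIV. \<Sum>j\<in>UNIV.
        (partial i (partial j f) q - (\<Sum>k\<in>UNIV. christoffel g k i j q * partial k f q)) * v $ i * w $ j)"

text \<open>\<open>curvature_endo g l i j k q\<close> is the coefficient of $\partial_l$ in
  $R(\partial_i,\partial_j)\partial_k
    = \nabla_i\nabla_j\partial_k - \nabla_j\nabla_i\partial_k$.\<close>

definition curvature_endo :: "'n metric \<Rightarrow> 'n \<Rightarrow> 'n \<Rightarrow> 'n \<Rightarrow> 'n \<Rightarrow> real^'n::finite \<Rightarrow> real" where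
  "curvature_endo g l i j k q =
     partial i (christoffel g l j k) q - partial j (christoffel g l i k) q
     + (\<Sum>m\<in>UNIV. christoffel g l i m q * christoffel g m j k q
                  - christoffel g l j m q * christoffel g m i k q)"

text \<open>The (0,4) curvature tensor $R_{ijkl} = g(R(\partial_i,\partial_j)\partial_l,\partial_k)$; with
  this sign, $R_{ijkl} = g_{ik}g_{jl} - g_{il}g_{jk}$ on the unit sphere.\<close>

definition riemann :: "'n metric \<Rightarrow> real^'n::finite \<Rightarrow> 'n \<Rightarrow> 'n \<Rightarrow> 'n \<Rightarrow> 'n \<Rightarrow> real" where
  "riemann g q i j k l = (\<Sum>m\<in>UNIV. g q $ k $ m * curvature_endo g m i j l q)"

definition ricci :: "'n metric \<Rightarrow> real^'n::finite \<Rightarrow> 'n \<Rightarrow> 'n \<Rightarrow> real" where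
  "ricci g q j l = (\<Sum>i\<in>UNIV. \<Sum>k\<in>UNIV. matrix_inv (g q) $ i $ k * riemann g q i j k l)"

definition scalar_curvature :: "'n metric \<Rightarrow> real^'n::finite \<Rightarrow> real" where
  "scalar_curvature g q = (\<Sum>j\<in>UNIV. \<Sum>l\<in>UNIV. matrix_inv (g q) $ j $ l * ricci g q j l)"

text \<open>Dimension at least 3 is intended.\<close>

definition weyl :: "'n metric \<Rightarrow> real^'n::finite \<Rightarrow> 'n \<Rightarrow> 'n \<Rightarrow> 'n \<Rightarrow> 'n \<Rightarrow> real" where
  "weyl g q i j k l =
     (let n = real CARD('n); G = g q; Ric = ricci g q; S = scalar_curvature g q in
      riemann g q i j k l
      - (Ric i k * G $ j $ l - Ric i l * G $ j $ k + G $ i $ k * Ric j l - G $ i $ l * Ric j k) / (n - 2)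
      + S * (G $ i $ k * G $ j $ l - G $ i $ l * G $ j $ k) / ((n - 1) * (n - 2)))"


text \<open>$\Lambda^2 T_q$ is modelled by the skew-symmetric matrices of contravariant components.\<close>

definition bivectors :: "(real^'n^'n::finite) set" where
  "bivectors = {\<omega>. transpose \<omega> = - \<omega>}"

definition wedge :: "real^'n \<Rightarrow> real^'n::finite \<Rightarrow> real^'n^'n" where
  "wedge v w = (\<chi> i j. v $ i * w $ j - w $ i * v $ j)"

text \<open>The Weyl operator is $\omega^{ij} \mapsto \frac12 W^{ij}{}_{kl}\,\omega^{kl}$. Equivalently
  $\langle W_q(v\wedge w), a\wedge b\rangle = W(a,b,v,w)$ for the inner product on $\Lambda^2$ with
  $\langle v\wedge w, a\wedge b\rangle = g(v,a)\,g(w,b) - g(v,b)\,g(w,a)$.\<close>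

definition weyl_operator :: "'n metric \<Rightarrow> real^'n \<Rightarrow> real^'n^'n \<Rightarrow> real^'n^'n::finite" where
  "weyl_operator g q \<omega> =
     (\<chi> i j. (\<Sum>a\<in>UNIV. \<Sum>b\<in>UNIV. \<Sum>k\<in>UNIV. \<Sum>l\<in>UNIV.
        matrix_inv (g q) $ i $ a * matrix_inv (g q) $ j $ b * weyl g q a b k l * \<omega> $ k $ l) / 2)"

definition wedge_perp :: "real^'n^'n \<Rightarrow> real^'n::finite \<Rightarrow> (real^'n^'n) set" where
  "wedge_perp G v = {wedge v w | w. ginner G w v = 0}"

definition eigenflag_direction ::
  "real^'n^'n \<Rightarrow> (real^'n^'n \<Rightarrow> real^'n^'n) \<Rightarrow> (real^'n::finite) set \<Rightarrow> bool" where
  "eigenflag_direction G W L \<longleftrightarrow>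
     (\<exists>v. v \<noteq> 0 \<and> L = span {v} \<and> W ` wedge_perp G v \<subseteq> wedge_perp G v)"

definition bivector_eigenspace ::
  "(real^'n^'n \<Rightarrow> real^'n^'n) \<Rightarrow> real \<Rightarrow> (real^'n^'n::finite) set" where
  "bivector_eigenspace W \<mu> = {\<omega> \<in> bivectors. W \<omega> = \<mu> *\<^sub>R \<omega>}"

definition type_B :: "real^4^4 \<Rightarrow> (real^4^4 \<Rightarrow> real^4^4) \<Rightarrow> bool" where
  "type_B G W \<longleftrightarrow>
     (\<exists>L. eigenflag_direction G W L) \<and>
     (\<exists>a b c. distinct [bivector_eigenspace W a, bivector_eigenspace W b, bivector_eigenspace W c] \<and>
        (\<forall>\<mu>\<in>{a, b, c}. dim (bivector_eigenspace W \<mu>) = 2))"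


definition limiting_carleman_weight ::
  "(real^'n) set \<Rightarrow> 'n metric \<Rightarrow> (real^'n::finite \<Rightarrow> real) \<Rightarrow> bool" where
  "limiting_carleman_weight V g \<phi> \<longleftrightarrow>
     smooth_on V \<phi> \<and>
     (\<forall>q\<in>V. gradient g \<phi> q \<noteq> 0) \<and>
     (\<forall>q\<in>V. \<forall>\<xi>.
        ginner (g q) \<xi> (gradient g \<phi> q) = 0 \<and> gnorm (g q) \<xi> = gnorm (g q) (gradient g \<phi> q) \<longrightarrow>
        hessian g \<phi> q (gradient g \<phi> q) (gradient g \<phi> q) + hessian g \<phi> q \<xi> \<xi> = 0)"


text \<open>The metric $dt^2 + dx^2 + x\,dy^2 + x^2\,dz^2$, with the coordinates $(t,x,y,z)$ numbered
  1 to 4.\<close>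

definition typeB_metric :: "4 metric" where
  "typeB_metric q =
     vector [vector [1, 0, 0, 0],
             vector [0, 1, 0, 0],
             vector [0, 0, q $ 2, 0],
             vector [0, 0, 0, (q $ 2)\<^sup>2]]"

lemma vector_4 [simp]:
  "(vector [a, b, c, d] :: 'a::zero^4) $ 1 = a"
  "(vector [a, b, c, d] :: 'a::zero^4) $ 2 = b"
  "(vector [a, b, c, d] :: 'a::zero^4) $ 3 = c"
  "(vector [a, b, c, d] :: 'a::zero^4) $ 4 = d"
  by (simp_all add: vector_def)

lemma partial_const [simp]: "partial i (\<lambda>p. c) = (\<lambda>p. 0)"
  by (simp add: partial_def fun_eq_iff)

lemma partial_coord: "partial i (\<lambda>p::real^'n::finite. p $ j) = (\<lambda>p. if i = j then 1 else 0)"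
proof
  fix q :: "real^'n"
  have "((\<lambda>s. q $ j + s * (axis i 1 :: real^'n) $ j) has_real_derivative axis i 1 $ j) (at 0)"
    by (auto intro!: derivative_eq_intros)
  then show "partial i (\<lambda>p. p $ j) q = (if i = j then 1 else 0)"
    by (auto simp: partial_def axis_def dest!: DERIV_imp_deriv)
qed

lemma partial_coord_square:
  "partial i (\<lambda>p::real^'n::finite. (p $ j)\<^sup>2) = (\<lambda>p. (if i = j then 2 else 0) * p $ j)"
proof
  fix q :: "real^'n"
  have "((\<lambda>s. (q $ j + s * (axis i 1 :: real^'n) $ j)\<^sup>2) has_real_derivative 2 * q $ j * axis i 1 $ j) (at 0)"
    by (auto intro!: derivative_eq_intros)
  then show "partial i (\<lambda>p. (p $ j)\<^sup>2) q = (if i = j then 2 else 0) * q $ j"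
    by (auto simp: partial_def axis_def dest!: DERIV_imp_deriv)
qed

lemma partial_coord_scaled:
  "partial i (\<lambda>p::real^'n::finite. c * p $ j) = (\<lambda>p. if i = j then c else 0)"
proof
  fix q :: "real^'n"
  have "((\<lambda>s. c * (q $ j + s * (axis i 1 :: real^'n) $ j)) has_real_derivative c * axis i 1 $ j) (at 0)"
    by (auto intro!: derivative_eq_intros)
  then show "partial i (\<lambda>p. c * p $ j) q = (if i = j then c else 0)"
    by (auto simp: partial_def axis_def dest!: DERIV_imp_deriv)
qed

lemma smooth_on_const: "smooth_on S (\<lambda>p. c)"
proof -
  have "Ck_on k S (\<lambda>p. c)" for k c
    by (induction k arbitrary: c) auto
  then show ?thesis by (simp add: smooth_on_def)
qed

lemma differentiable_coord: "(\<lambda>p::real^'n::finite. p $ j) differentiable_on S"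
  by (simp add: bounded_linear_imp_differentiable_on bounded_linear_vec_nth)

lemma smooth_on_coord_scaled: "smooth_on S (\<lambda>p. c * p $ j)"
  unfolding smooth_on_def
proof
  fix k show "Ck_on k S (\<lambda>p. c * p $ j)"
    using smooth_on_const[of S] 
    by (cases k) (auto simp: smooth_on_def partial_coord_scaled
          intro!: continuous_intros differentiable_on_mult differentiable_coord)
qed

lemma smooth_on_coord: "smooth_on S (\<lambda>p. p $ j)"
  using smooth_on_coord_scaled[of S 1 j] by simp

lemma smooth_on_coord_square: "smooth_on S (\<lambda>p. (p $ j)\<^sup>2)"
  unfolding smooth_on_def
proof
  have "(\<lambda>p. (p $ j)\<^sup>2) differentiable_on S"
    unfolding power2_eq_square by (intro differentiable_on_mult differentiable_coord)
  then show "Ck_on k S (\<lambda>p. (p $ j)\<^sup>2)" for k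
    using smooth_on_coord_scaled[of S]
    by (cases k) (auto simp: smooth_on_def partial_coord_square intro!: continuous_intros)
qed

lemma riemannian_metric_typeB_metric: "riemannian_metric_on {q. q $ 2 > 0} typeB_metric"
proof -
  have "smooth_on S (\<lambda>q. typeB_metric q $ i $ j)" for S i j
    using exhaust_4[of i] exhaust_4[of j]
    by (auto simp: typeB_metric_def smooth_on_const smooth_on_coord smooth_on_coord_square)
  moreover have "transpose (typeB_metric q) = typeB_metric q" for q
    by (simp add: vec_eq_iff transpose_def forall_4 typeB_metric_def)
  moreover have "v \<bullet> (typeB_metric q *v v) > 0" if pos: "q $ 2 > 0" and nz: "v \<noteq> 0" for q v
  proof -
    have eq: "v \<bullet> (typeB_metric q *v v) =
        (v $ 1)\<^sup>2 + (v $ 2)\<^sup>2 + q $ 2 * (v $ 3)\<^sup>2 + (q $ 2)\<^sup>2 * (v $ 4)\<^sup>2"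
      by (simp add: inner_vec_def matrix_vector_mult_def sum_4 typeB_metric_def power2_eq_square)
    have nonneg: "0 \<le> (v $ 1)\<^sup>2" "0 \<le> (v $ 2)\<^sup>2" "0 \<le> q $ 2 * (v $ 3)\<^sup>2"
        "0 \<le> (q $ 2)\<^sup>2 * (v $ 4)\<^sup>2"
      using pos by simp_all
    obtain i where "v $ i \<noteq> 0"
      using nz by (auto simp: vec_eq_iff)
    then have "0 < (v $ 1)\<^sup>2 \<or> 0 < (v $ 2)\<^sup>2 \<or> 0 < q $ 2 * (v $ 3)\<^sup>2 \<or> 0 < (q $ 2)\<^sup>2 * (v $ 4)\<^sup>2"
      using pos exhaust_4[of i] by auto
    then show ?thesis
      unfolding eq using nonneg by linarith
  qed
  ultimately show ?thesis
    by (simp add: riemannian_metric_on_def)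
qed

end

theory Submission
  imports Defs
begin

text \<open>
  In the coordinate frame the Christoffel symbols depend on \<open>x\<close> only, and the Weyl operator turns out
  to be diagonal on the bivectors \<open>\<partial>\<^sub>i \<and> \<partial>\<^sub>j\<close>, with eigenvalue \<open>-5/(24 x\<^sup>2)\<close> on the pairs \<open>tx, yz\<close>,
  \<open>1/(24 x\<^sup>2)\<close> on \<open>ty, xz\<close> and \<open>1/(6 x\<^sup>2)\<close> on \<open>tz, xy\<close>. For such an operator with distinct
  eigenvalues, an eigenflag direction cannot have two nonzero coordinates.
  For \<open>\<phi> \<in> {t, y, z}\<close> the Hessian of \<open>\<phi>\<close> vanishes on \<open>\<nabla>\<phi>\<close> and on its orthogonal complement, while the
  Hessian of \<open>x\<close> equals \<open>1/(2 x)\<close> on the unit vector \<open>\<partial>\<^sub>y / sqrt x\<close>, and vanishes on \<open>\<nabla>x\<close>.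
\<close>

subsection \<open>Diagonal operators on bivectors\<close>

lemma wedge_in_bivectors: "wedge v w \<in> bivectors"
  by (simp add: wedge_def bivectors_def transpose_def vec_eq_iff)

lemma bivectors_skew:
  assumes "\<omega> \<in> bivectors"
  shows "\<omega> $ j $ i = - \<omega> $ i $ j"
proof -
  have "transpose \<omega> $ i $ j = (- \<omega>) $ i $ j"
    using assms by (simp only: bivectors_def mem_Collect_eq)
  then show ?thesis by (simp add: transpose_def)
qed

text \<open>An eigenvector can have a nonzero entry only where its weight \<open>m p r\<close>
  equals the eigenvalue. The diagonal entries of a bivector vanish by skewness, so \<open>m\<close>
  is constrained only off the diagonal.\<close>

lemma bivector_eigenspace_eq_span:
  fixes W :: "real^'n^'n \<Rightarrow> real^'n^'n::finite"
  assumes W: "\<And>\<omega> p r. \<omega> \<in> bivectors \<Longrightarrow> W \<omega> $ p $ r = m p r * \<omega> $ p $ r"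
    and m: "\<And>p r. p \<noteq> r \<Longrightarrow> m p r = \<mu> \<longleftrightarrow> {p, r} = {i, j} \<or> {p, r} = {k, l}"
    and ijkl: "distinct [i, j, k, l]"
  shows "bivector_eigenspace W \<mu> = span {wedge (axis i 1) (axis j 1), wedge (axis k 1) (axis l 1)}"
    (is "_ = span {?A, ?B}")
proof (intro equalityI subsetI)
  fix \<omega> assume "\<omega> \<in> bivector_eigenspace W \<mu>"
  then have \<omega>: "\<omega> \<in> bivectors" and eig: "W \<omega> = \<mu> *\<^sub>R \<omega>"
    by (simp_all add: bivector_eigenspace_def)
  have skew: "\<omega> $ r $ p = - \<omega> $ p $ r" for p r
    using \<omega> by (rule bivectors_skew)
  have zero: "\<omega> $ p $ r = 0" if "{p, r} \<noteq> {i, j}" "{p, r} \<noteq> {k, l}" for p r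
  proof (cases "p = r")
    case True
    then show ?thesis using skew[of p p] by simp
  next
    case False
    have "m p r * \<omega> $ p $ r = \<mu> * \<omega> $ p $ r"
      using W[OF \<omega>, of p r] by (auto simp: eig)
    then show ?thesis using m[OF False] that by auto
  qed
  have "\<omega> = \<omega> $ i $ j *\<^sub>R ?A + \<omega> $ k $ l *\<^sub>R ?B"
  proof -
    have "\<omega> $ p $ r = (\<omega> $ i $ j *\<^sub>R ?A + \<omega> $ k $ l *\<^sub>R ?B) $ p $ r" for p r
    proof -
      consider "p = i \<and> r = j" | "p = j \<and> r = i" | "p = k \<and> r = l" | "p = l \<and> r = k"
        | "{p, r} \<noteq> {i, j}" "{p, r} \<noteq> {k, l}"
        by (metis doubleton_eq_iff)
      then show ?thesis
      proof cases
        case 5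
        then show ?thesis
          by (subst zero) (auto simp: wedge_def axis_def)
      qed (use ijkl skew[of i j] skew[of k l] in \<open>auto simp: wedge_def axis_def\<close>)
    qed
    then show ?thesis unfolding vec_eq_iff by blast
  qed
  then show "\<omega> \<in> span {?A, ?B}"
    by (metis (no_types, lifting) insertI1 insertI2 span_add span_base span_scale)
next
  fix \<omega> assume "\<omega> \<in> span {?A, ?B}"
  then obtain s t where \<omega>: "\<omega> = s *\<^sub>R ?A + t *\<^sub>R ?B"
    by (auto simp: span_insert algebra_simps)
  have biv: "\<omega> \<in> bivectors"
    by (simp add: \<omega> bivectors_def wedge_def transpose_def vec_eq_iff algebra_simps)
  have "m p r * \<omega> $ p $ r = \<mu> * \<omega> $ p $ r" for p r
  proof (cases "p \<noteq> r \<and> m p r = \<mu>")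
    case False
    then have "\<omega> $ p $ r = 0"
      using m[of p r] by (auto simp: \<omega> wedge_def axis_def)
    then show ?thesis by simp
  qed simp
  then show "\<omega> \<in> bivector_eigenspace W \<mu>"
    using biv by (simp add: bivector_eigenspace_def vec_eq_iff W)
qed

lemma dim_span_wedge_axis:
  fixes i j k l :: "'n::finite"
  assumes "distinct [i, j, k, l]"
  shows "dim (span {wedge (axis i 1) (axis j 1), wedge (axis k 1) (axis l 1) :: real^'n^'n}) = 2"
    (is "dim (span {?A, ?B}) = 2")
proof -
  \<comment> \<open>Reading off the entries \<open>(i, j)\<close> and \<open>(k, l)\<close> gives a
    dual pair of functionals, which yields independence.\<close>
  have A: "?A $ i $ j = 1" "?A $ k $ l = 0" and B: "?B $ i $ j = 0" "?B $ k $ l = 1"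
    using assms by (auto simp: wedge_def axis_def)
  have "?A \<noteq> ?B"
    by (rule notI) (use A B in simp)
  moreover have "?A \<notin> span {?B}"
    using A B by (auto simp: span_singleton dest!: arg_cong[where f = "\<lambda>\<omega>. \<omega> $ i $ j"])
  moreover have "?B \<noteq> 0" using B by auto
  ultimately have "independent {?A, ?B}"
    by (simp add: independent_insert)
  from dim_span_eq_card_independent[OF this] \<open>?A \<noteq> ?B\<close> show ?thesis by simp
qed

text \<open>For \<open>w = \<partial>\<^sub>j\<close> the condition \<open>v \<and> W(v \<and> w) = 0\<close> has the components
  \<open>v\<^sub>i v\<^sub>k (m\<^sub>i\<^sub>j - m\<^sub>k\<^sub>j) = 0\<close>.\<close>

lemma eigenflag_directions_eq_axes:
  fixes W :: "real^'n^'n \<Rightarrow> real^'n^'n::finite"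
  assumes W: "\<And>\<omega> p r. \<omega> \<in> bivectors \<Longrightarrow> W \<omega> $ p $ r = m p r * \<omega> $ p $ r"
    and sym: "\<And>p r. m p r = m r p"
    and m: "\<And>i k. i \<noteq> k \<Longrightarrow> \<exists>j. j \<noteq> i \<and> j \<noteq> k \<and> m i j \<noteq> m k j"
    and diag: "\<And>i j. i \<noteq> j \<Longrightarrow> G $ i $ j = 0"
    and pos: "\<And>v. v \<noteq> 0 \<Longrightarrow> ginner G v v > 0"
  shows "{L. eigenflag_direction G W L} = range (\<lambda>i. span {axis i 1})"
proof (intro equalityI subsetI)
  fix L assume "L \<in> {L. eigenflag_direction G W L}"
  then obtain v where v: "v \<noteq> 0" "L = span {v}" "W ` wedge_perp G v \<subseteq> wedge_perp G v"
    by (auto simp: eigenflag_direction_def)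
  have "v $ i * v $ k = 0" if ik: "i \<noteq> k" for i k
  proof -
    obtain j where j: "j \<noteq> i" "j \<noteq> k" "m i j \<noteq> m k j"
      using m[OF ik] by auto
    \<comment> \<open>\<open>w\<close> is the part of e_j orthogonal to \<open>v\<close>.
      Subtracting a multiple of \<open>v\<close> leaves the wedge with \<open>v\<close> unchanged,
      so the eigenflag property applies to \<open>wedge v (axis j 1)\<close> itself.\<close>
    define w where "w = axis j 1 - (ginner G (axis j 1) v / ginner G v v) *\<^sub>R v"
    have wv: "wedge v w = wedge v (axis j 1)"
      by (simp add: wedge_def w_def vec_eq_iff algebra_simps)
    have "ginner G w v = 0"
      using pos[OF v(1)] by (simp add: w_def ginner_def inner_diff_left)
    then have "W (wedge v w) \<in> wedge_perp G v"
      using v(3) by (auto simp: wedge_perp_def)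
    then obtain u where u: "W (wedge v (axis j 1)) = wedge v u"
      by (auto simp: wedge_perp_def wv)
    have comp: "m p r * wedge v (axis j 1) $ p $ r = wedge v u $ p $ r" for p r
      using W[OF wedge_in_bivectors, of v "axis j 1" p r] u by simp
    \<comment> \<open>This is the \<open>(i, j, k)\<close> component of the vanishing triple wedge
      of \<open>v\<close>, \<open>v\<close> and \<open>u\<close>; the terms with m_ij and m_jk are
      the ones that survive.\<close>
    have "wedge v u $ i $ j * v $ k + wedge v u $ j $ k * v $ i + wedge v u $ k $ i * v $ j = 0"
      by (simp add: wedge_def algebra_simps)
    then have "v $ i * v $ k * (m i j - m k j) = 0"
      using j ik sym[of k j] by (simp add: comp[symmetric]) (simp add: wedge_def axis_def algebra_simps)
    then show ?thesis using j by simp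
  qed
  moreover obtain i where i: "v $ i \<noteq> 0" using v(1) by (auto simp: vec_eq_iff)
  ultimately have vi: "v = v $ i *\<^sub>R axis i 1"
    by (auto simp: vec_eq_iff axis_def)
  have "axis i 1 = (1 / v $ i) *\<^sub>R v"
    using i by (subst vi) (simp add: axis_def vec_eq_iff)
  then have "span {v} = span {axis i 1}"
    unfolding span_eq by (metis empty_subsetI insert_subset span_base span_scale singletonI vi)
  then show "L \<in> range (\<lambda>i. span {axis i 1})"
    using v(2) by auto
next
  fix L assume "L \<in> range (\<lambda>i. span {axis i 1 :: real^'n})"
  then obtain i where L: "L = span {axis i 1 :: real^'n}" by auto
  have perp: "ginner G w (axis i 1) = w $ i * G $ i $ i" for w
  proof -
    have "ginner G w (axis i 1) = (\<Sum>p\<in>UNIV. w $ p * G $ p $ i)"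
      by (simp add: ginner_def inner_vec_def matrix_vector_mult_def axis_def if_distrib cong: if_cong)
    also have "\<dots> = (\<Sum>p\<in>UNIV. if p = i then w $ i * G $ i $ i else 0)"
      by (rule sum.cong) (auto simp: diag)
    finally show ?thesis by simp
  qed
  have "W (wedge (axis i 1) w) \<in> wedge_perp G (axis i 1)" if "ginner G w (axis i 1) = 0" for w
  proof -
    \<comment> \<open>The only nonzero entries lie in row and column \<open>i\<close>, so
      \<open>W\<close> rescales the coordinates of \<open>w\<close> by \<open>m i r\<close>. For
      diagonal \<open>G\<close> this preserves orthogonality to e_i, which by \<open>perp\<close>
      depends on the \<open>i\<close>-th coordinate alone.\<close>
    have "W (wedge (axis i 1) w) = wedge (axis i 1) (\<chi> r. m i r * w $ r)"
      by (simp add: vec_eq_iff W[OF wedge_in_bivectors]) (auto simp: wedge_def axis_def sym)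
    moreover have "ginner G (\<chi> r. m i r * w $ r) (axis i 1) = 0"
      using that by (simp add: perp)
    ultimately show ?thesis by (auto simp: wedge_perp_def)
  qed
  then show "L \<in> {L. eigenflag_direction G W L}"
    unfolding eigenflag_direction_def mem_Collect_eq L
    by (intro exI[of _ "axis i 1"]) (auto simp: wedge_perp_def[of _ "axis i 1"] axis_eq_0_iff)
qed

text \<open>The three ways of splitting the four indices into two pairs correspond to the three
  eigenvalues of a Weyl operator of type B.\<close>

definition pair_weight :: "real \<Rightarrow> real \<Rightarrow> real \<Rightarrow> 4 \<Rightarrow> 4 \<Rightarrow> real" where
  "pair_weight a b c i j =
    (if {i, j} = {1, 2} \<or> {i, j} = {3, 4} then a
     else if {i, j} = {1, 3} \<or> {i, j} = {2, 4} then b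
     else if {i, j} = {1, 4} \<or> {i, j} = {2, 3} then c
     else 0)"

lemma pair_weight_commute: "pair_weight a b c i j = pair_weight a b c j i"
  by (simp add: pair_weight_def insert_commute)

text \<open>For \<open>j\<close> outside \<open>{i, k}\<close>, the pairs \<open>{i, j}\<close> and
  \<open>{k, j}\<close> are different but share \<open>j\<close>. They are therefore not
  complementary, and belong to different splittings with different weights. The witness is the first
  admissible index; one of 1, 2, 3 always avoids \<open>{i, k}\<close>.\<close>

lemma pair_weight_separates:
  assumes "distinct [a, b, c]" "i \<noteq> k"
  shows "\<exists>j. j \<noteq> i \<and> j \<noteq> k \<and> pair_weight a b c i j \<noteq> pair_weight a b c k j"
  using assms exhaust_4[of i] exhaust_4[of k]
  by (intro exI[of _ "if 1 \<notin> {i, k} then 1 else if 2 \<notin> {i, k} then 2 else 3"], elim disjE)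
    (simp_all add: pair_weight_def doubleton_eq_iff)

lemma pair_weight_eq_iff:
  assumes "distinct [a, b, c]" "p \<noteq> r"
  shows "pair_weight a b c p r = a \<longleftrightarrow> {p, r} = {1, 2} \<or> {p, r} = {3, 4}"
    and "pair_weight a b c p r = b \<longleftrightarrow> {p, r} = {1, 3} \<or> {p, r} = {2, 4}"
    and "pair_weight a b c p r = c \<longleftrightarrow> {p, r} = {1, 4} \<or> {p, r} = {2, 3}"
  using assms exhaust_4[of p] exhaust_4[of r]
  by (elim disjE; simp add: pair_weight_def doubleton_eq_iff)+

lemma type_B_pair_weight:
  assumes W: "\<And>\<omega> p r. \<omega> \<in> bivectors \<Longrightarrow> W \<omega> $ p $ r = pair_weight a b c p r * \<omega> $ p $ r"
    and abc: "distinct [a, b, c]"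
    and L: "\<exists>L. eigenflag_direction G W L"
  shows "type_B G W"
proof -
  have "bivector_eigenspace W a = span {wedge (axis 1 1) (axis 2 1), wedge (axis 3 1) (axis 4 1)}"
    by (rule bivector_eigenspace_eq_span[where m = "pair_weight a b c", OF W])
      (simp_all add: pair_weight_eq_iff[OF abc])
  then have a: "dim (bivector_eigenspace W a) = 2"
    using dim_span_wedge_axis[of 1 2 3 "4::4"] by simp
  have "bivector_eigenspace W b = span {wedge (axis 1 1) (axis 3 1), wedge (axis 2 1) (axis 4 1)}"
    by (rule bivector_eigenspace_eq_span[where m = "pair_weight a b c", OF W])
      (simp_all add: pair_weight_eq_iff[OF abc])
  then have b: "dim (bivector_eigenspace W b) = 2"
    using dim_span_wedge_axis[of 1 3 2 "4::4"] by simp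
  have "bivector_eigenspace W c = span {wedge (axis 1 1) (axis 4 1), wedge (axis 2 1) (axis 3 1)}"
    by (rule bivector_eigenspace_eq_span[where m = "pair_weight a b c", OF W])
      (simp_all add: pair_weight_eq_iff[OF abc])
  then have c: "dim (bivector_eigenspace W c) = 2"
    using dim_span_wedge_axis[of 1 4 2 "3::4"] by simp
  \<comment> \<open>Eigenspaces for different values meet only in 0, so they can coincide only if
    both are zero, contrary to dimension 2.\<close>
  have distinct: "bivector_eigenspace W x \<noteq> bivector_eigenspace W y"
    if "x \<noteq> y" "dim (bivector_eigenspace W x) = 2" for x y
  proof
    assume "bivector_eigenspace W x = bivector_eigenspace W y"
    then have "bivector_eigenspace W x \<subseteq> {0}"
      using that(1) by (force simp: bivector_eigenspace_def set_eq_iff)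
    then show False using that(2) by (simp add: dim_eq_0[THEN iffD2])
  qed
  have "distinct [bivector_eigenspace W a, bivector_eigenspace W b, bivector_eigenspace W c]"
    using abc distinct a b c by simp
  then show ?thesis
    unfolding type_B_def using L a b c by blast
qed

subsection \<open>Curvature of the metric\<close>

text \<open>The formulas for the Christoffel symbols hold only for x > 0. Openness of
  \<open>S\<close> makes this local agreement with a function of one coordinate sufficient for
  differentiation.\<close>

lemma partial_fun_coord:
  fixes F :: "real^'n::finite \<Rightarrow> real"
  assumes S: "open S" "q $ j \<in> S"
    and F: "\<And>p. p $ j \<in> S \<Longrightarrow> F p = f (p $ j)"
    and f: "(f has_real_derivative D) (at (q $ j))"
  shows "partial i F q = (if i = j then D else 0)"
proof -
  let ?a = "(axis i 1 :: real^'n) $ j"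
  have 1: "((\<lambda>s. q $ j + s * ?a) has_real_derivative ?a) (at 0)"
    by (auto intro!: derivative_eq_intros)
  have 2: "((\<lambda>s. f (q $ j + s * ?a)) has_real_derivative D * ?a) (at 0)"
    using DERIV_chain2[OF _ 1, of f D] f by simp
  have "((\<lambda>s. q $ j + s * ?a) \<longlongrightarrow> q $ j) (nhds 0)"
    by (auto intro!: tendsto_eq_intros filterlim_ident)
  from topological_tendstoD[OF this S]
  have "\<forall>\<^sub>F s in nhds 0. F (q + s *\<^sub>R axis i 1) = f (q $ j + s * ?a)"
    by (auto elim!: eventually_mono simp: F)
  then have "partial i F q = deriv (\<lambda>s. f (q $ j + s * ?a)) 0"
    unfolding partial_def by (rule deriv_cong_ev) simp
  then show ?thesis using DERIV_imp_deriv[OF 2] by (simp add: axis_def)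
qed

section \<open>The metric, its inverse and the Levi-Civita connection\<close>

lemma typeB_metric_nth:
  "typeB_metric q $ i $ j =
    (if i = j then if i = 3 then q $ 2 else if i = 4 then (q $ 2)\<^sup>2 else 1 else 0)"
  using exhaust_4[of i] exhaust_4[of j] by (auto simp: typeB_metric_def)

text \<open>\<open>matrix_inv\<close> is defined by choice; uniqueness of two-sided inverses
  identifies the chosen matrix.\<close>

lemma matrix_inv_eqI:
  fixes A :: "'a::semiring_1^'n^'m" and B :: "'a^'m^'n"
  assumes "A ** B = mat 1" "B ** A = mat 1"
  shows "matrix_inv A = B"
proof -
  have "A ** matrix_inv A = mat 1 \<and> matrix_inv A ** A = mat 1"
    unfolding matrix_inv_def by (rule someI[of _ B]) (simp add: assms)
  then have "matrix_inv A = B ** A ** matrix_inv A"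
    by (simp add: assms)
  also have "\<dots> = B"
    using \<open>A ** matrix_inv A = mat 1 \<and> _\<close> by (simp flip: matrix_mul_assoc)
  finally show ?thesis .
qed

lemma matrix_inv_typeB_metric_nth:
  assumes "q $ 2 > 0"
  shows "matrix_inv (typeB_metric q) $ i $ j =
    (if i = j then if i = 3 then 1 / q $ 2 else if i = 4 then 1 / (q $ 2)\<^sup>2 else 1 else 0)"
proof -
  define A :: "real^4^4" where "A = (\<chi> i j.
    (if i = j then if i = 3 then 1 / q $ 2 else if i = 4 then 1 / (q $ 2)\<^sup>2 else 1 else 0))"
  have "typeB_metric q ** A = mat 1"
    using assms by (simp add: A_def vec_eq_iff forall_4 matrix_matrix_mult_def sum_4 typeB_metric_nth mat_def)
  moreover have "A ** typeB_metric q = mat 1"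
    using assms by (simp add: A_def vec_eq_iff forall_4 matrix_matrix_mult_def sum_4 typeB_metric_nth mat_def)
  ultimately have "matrix_inv (typeB_metric q) = A" by (rule matrix_inv_eqI)
  then show ?thesis by (simp add: A_def)
qed

lemma partial_typeB_metric:
  "partial m (\<lambda>p. typeB_metric p $ i $ j) q =
    (if m = 2 \<and> i = j then if i = 3 then 1 else if i = 4 then 2 * q $ 2 else 0 else 0)"
  using exhaust_4[of i] exhaust_4[of j]
  by (elim disjE) (simp_all add: typeB_metric_nth partial_coord partial_coord_square)

text \<open>For a diagonal metric with entries h_i depending on x alone, the symbols with
  \<open>k = 2\<close> and \<open>i = j\<close> are -h_i'/2, and those with \<open>k = i\<close> and
  other lower index 2 are h_i'/(2 h_i). Only h_3 = x and h_4 = x^2 contribute.\<close>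

lemma christoffel_typeB_metric:
  assumes "q $ 2 > 0"
  shows "christoffel typeB_metric k i j q =
    (if k = 2 \<and> i = 3 \<and> j = 3 then - 1 / 2
     else if k = 2 \<and> i = 4 \<and> j = 4 then - (q $ 2)
     else if k = 3 \<and> (i = 2 \<and> j = 3 \<or> i = 3 \<and> j = 2) then 1 / (2 * q $ 2)
     else if k = 4 \<and> (i = 2 \<and> j = 4 \<or> i = 4 \<and> j = 2) then 1 / (q $ 2)
     else 0)"
  unfolding christoffel_def partial_typeB_metric sum_4 matrix_inv_typeB_metric_nth[OF assms]
  using exhaust_4[of k] exhaust_4[of i] exhaust_4[of j] assms
  by (elim disjE) (simp_all add: power2_eq_square)

lemma partial_christoffel_typeB_metric:
  assumes "q $ 2 > 0"
  shows "partial m (christoffel typeB_metric k i j) q =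
    (if m = 2 then
       if k = 2 \<and> i = 4 \<and> j = 4 then - 1
       else if k = 3 \<and> (i = 2 \<and> j = 3 \<or> i = 3 \<and> j = 2) then - 1 / (2 * (q $ 2)\<^sup>2)
       else if k = 4 \<and> (i = 2 \<and> j = 4 \<or> i = 4 \<and> j = 2) then - 1 / (q $ 2)\<^sup>2
       else 0
     else 0)"
proof -
  note rule = partial_fun_coord[of "{0<..}" q 2 "christoffel typeB_metric k i j" _ _ m, OF open_greaterThan]
  consider "k = 2 \<and> i = 4 \<and> j = 4"
    | "k = 3 \<and> (i = 2 \<and> j = 3 \<or> i = 3 \<and> j = 2)"
    | "k = 4 \<and> (i = 2 \<and> j = 4 \<or> i = 4 \<and> j = 2)"
    | (const) "\<not> (k = 2 \<and> i = 4 \<and> j = 4)" "\<not> (k = 3 \<and> (i = 2 \<and> j = 3 \<or> i = 3 \<and> j = 2))"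
      "\<not> (k = 4 \<and> (i = 2 \<and> j = 4 \<or> i = 4 \<and> j = 2))"
    by blast
  then show ?thesis
  proof cases
    case 1
    then show ?thesis
      using assms by (subst rule[where f = uminus and D = "-1"])
        (auto simp: christoffel_typeB_metric intro!: derivative_eq_intros)
  next
    case 2
    then show ?thesis
      using assms by (subst rule[where f = "\<lambda>x. 1 / (2 * x)" and D = "- 1 / (2 * (q $ 2)\<^sup>2)"])
        (auto simp: christoffel_typeB_metric field_simps power2_eq_square intro!: derivative_eq_intros)
  next
    case 3
    then show ?thesis
      using assms by (subst rule[where f = "\<lambda>x. 1 / x" and D = "- 1 / (q $ 2)\<^sup>2"])
        (auto simp: christoffel_typeB_metric field_simps power2_eq_square intro!: derivative_eq_intros)
  next
    case const
    then show ?thesis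
      \<comment> \<open>The remaining symbols are constant: -1/2 for \<open>k = 2\<close>,
        \<open>i = j = 3\<close>, and 0 otherwise.\<close>
      using assms by (subst rule[where f = "\<lambda>x. if k = 2 \<and> i = 3 \<and> j = 3 then - 1 / 2 else 0" and D = 0])
        (auto simp: christoffel_typeB_metric)
  qed
qed

section \<open>Riemann, Ricci, scalar and Weyl curvature\<close>

lemma curvature_endo_typeB_metric:
  assumes "q $ 2 > 0"
  shows "curvature_endo typeB_metric l i j k q =
    (if l = 2 \<and> i = 2 \<and> j = 3 \<and> k = 3 then 1 / (4 * q $ 2)
     else if l = 2 \<and> i = 3 \<and> j = 2 \<and> k = 3 then - 1 / (4 * q $ 2)
     else if l = 3 \<and> i = 3 \<and> j = 2 \<and> k = 2 then 1 / (4 * (q $ 2)\<^sup>2)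
     else if l = 3 \<and> i = 2 \<and> j = 3 \<and> k = 2 then - 1 / (4 * (q $ 2)\<^sup>2)
     else if l = 3 \<and> i = 3 \<and> j = 4 \<and> k = 4 then - 1 / 2
     else if l = 3 \<and> i = 4 \<and> j = 3 \<and> k = 4 then 1 / 2
     else if l = 4 \<and> i = 4 \<and> j = 3 \<and> k = 3 then - 1 / (2 * q $ 2)
     else if l = 4 \<and> i = 3 \<and> j = 4 \<and> k = 3 then 1 / (2 * q $ 2)
     else 0)"
  unfolding curvature_endo_def partial_christoffel_typeB_metric[OF assms]
    christoffel_typeB_metric[OF assms] sum_4
  using exhaust_4[of k] exhaust_4[of i] exhaust_4[of j] exhaust_4[of l] assms
  by (elim disjE) (simp_all add: field_simps power2_eq_square)

text \<open>The lengths of the y and z coordinate fields are sqrt x and x. The xy-plane thus has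
  sectional curvature 1/(4 x^2), the yz-plane -1/(2 x^2), and the xz-plane is flat because its
  factor is linear. The coefficients are these curvatures times g_ii g_jj.\<close>

lemma riemann_typeB_metric:
  assumes "q $ 2 > 0"
  shows "riemann typeB_metric q i j k l =
    (if i \<noteq> j \<and> {i, j} = {2, 3} then 1 / (4 * q $ 2)
     else if i \<noteq> j \<and> {i, j} = {3, 4} then - q $ 2 / 2 else 0) *
    ((if i = k \<and> j = l then 1 else 0) - (if i = l \<and> j = k then 1 else 0))"
  unfolding riemann_def curvature_endo_typeB_metric[OF assms] typeB_metric_nth sum_4
  using exhaust_4[of k] exhaust_4[of i] exhaust_4[of j] exhaust_4[of l] assms
  by (elim disjE) (simp_all add: doubleton_eq_iff field_simps power2_eq_square)

lemma ricci_typeB_metric: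
  assumes "q $ 2 > 0"
  shows "ricci typeB_metric q j l =
    (if j = l then
       if j = 2 then 1 / (4 * (q $ 2)\<^sup>2)
       else if j = 3 then - 1 / (4 * q $ 2)
       else if j = 4 then - 1 / 2
       else 0
     else 0)"
  unfolding ricci_def riemann_typeB_metric[OF assms] matrix_inv_typeB_metric_nth[OF assms] sum_4
  using exhaust_4[of j] exhaust_4[of l] assms
  by (elim disjE) (simp_all add: doubleton_eq_iff field_simps power2_eq_square)

lemma scalar_curvature_typeB_metric:
  assumes "q $ 2 > 0"
  shows "scalar_curvature typeB_metric q = - 1 / (2 * (q $ 2)\<^sup>2)"
  unfolding scalar_curvature_def ricci_typeB_metric[OF assms] matrix_inv_typeB_metric_nth[OF assms] sum_4
  using assms by (simp add: field_simps power2_eq_square)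

text \<open>On a coordinate plane the weight is K_ij - (r_i + r_j)/2 + S/6, with K the sectional
  curvature, r_i the Ricci curvature of the unit coordinate vector and S the scalar curvature.
  Complementary planes receive equal values because the Weyl tensor is trace-free in dimension 4.
  For \<open>i = j\<close> the metric factor vanishes, matching the default weight 0.\<close>

lemma weyl_typeB_metric:
  assumes "q $ 2 > 0"
  shows "weyl typeB_metric q i j k l =
    pair_weight (- 5 / (24 * (q $ 2)\<^sup>2)) (1 / (24 * (q $ 2)\<^sup>2)) (1 / (6 * (q $ 2)\<^sup>2)) i j *
    (typeB_metric q $ i $ k * typeB_metric q $ j $ l - typeB_metric q $ i $ l * typeB_metric q $ j $ k)"
  unfolding weyl_def Let_def riemann_typeB_metric[OF assms] ricci_typeB_metric[OF assms]
    scalar_curvature_typeB_metric[OF assms] typeB_metric_nth pair_weight_def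
  using exhaust_4[of k] exhaust_4[of i] exhaust_4[of j] exhaust_4[of l] assms
  by (elim disjE) (simp_all add: doubleton_eq_iff field_simps power2_eq_square)


lemma weyl_operator_typeB_metric:
  assumes "q $ 2 > 0" "\<omega> \<in> bivectors"
  shows "weyl_operator typeB_metric q \<omega> $ i $ j =
    pair_weight (- 5 / (24 * (q $ 2)\<^sup>2)) (1 / (24 * (q $ 2)\<^sup>2)) (1 / (6 * (q $ 2)\<^sup>2)) i j *
    \<omega> $ i $ j"
proof -
  let ?m = "pair_weight (- 5 / (24 * (q $ 2)\<^sup>2)) (1 / (24 * (q $ 2)\<^sup>2)) (1 / (6 * (q $ 2)\<^sup>2))"
  have skew: "\<omega> $ j $ i = - \<omega> $ i $ j"
    using assms(2) by (rule bivectors_skew)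
  \<comment> \<open>Raising the indices cancels the metric factors. The sum over \<open>k\<close>
    and \<open>l\<close> meets both orderings of the pair; skewness then turns the difference into
    twice one entry, cancelling the factor 1/2.\<close>
  have "weyl_operator typeB_metric q \<omega> $ i $ j = ?m i j * (\<omega> $ i $ j - \<omega> $ j $ i) / 2"
    unfolding weyl_operator_def weyl_typeB_metric[OF assms(1)] typeB_metric_nth
       matrix_inv_typeB_metric_nth[OF assms(1)]
    using exhaust_4[of i] exhaust_4[of j] assms(1)
    by (elim disjE) (simp_all add: sum_4 field_simps)
  then show ?thesis by (simp add: skew)
qed

section \<open>Gradients, Hessians and Carleman weights among the coordinates\<close>

lemma gradient_coord_typeB_metric:
  assumes "q $ 2 > 0"
  shows "gradient typeB_metric (\<lambda>p. p $ c) q = axis c (matrix_inv (typeB_metric q) $ c $ c)"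
  by (simp add: gradient_def partial_coord vec_eq_iff matrix_vector_mult_def axis_def sum_4
     matrix_inv_typeB_metric_nth[OF assms] forall_4)

text \<open>The second partial derivatives of a coordinate vanish, leaving only the connection
  term.\<close>

lemma hessian_coord:
  "hessian g (\<lambda>p. p $ c) q v w = - (\<Sum>i\<in>UNIV. \<Sum>j\<in>UNIV. christoffel g c i j q * v $ i * w $ j)"
  by (simp add: hessian_def partial_coord sum_negf if_distrib cong: if_cong)

lemma limiting_carleman_weight_coord_typeB_metric:
  assumes "U \<subseteq> {q. q $ 2 > 0}" "c \<noteq> 2"
  shows "limiting_carleman_weight U typeB_metric (\<lambda>q. q $ c)"
  unfolding limiting_carleman_weight_def
proof (intro conjI ballI allI impI)
  show "smooth_on U (\<lambda>q. q $ c)" by (rule smooth_on_coord)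
  fix q assume "q \<in> U"
  then have q: "q $ 2 > 0" using assms by auto
  note grad = gradient_coord_typeB_metric[OF q]
  show "gradient typeB_metric (\<lambda>p. p $ c) q \<noteq> 0"
    using q by (simp add: grad axis_eq_0_iff matrix_inv_typeB_metric_nth)
  fix \<xi> assume "ginner (typeB_metric q) \<xi> (gradient typeB_metric (\<lambda>p. p $ c) q) = 0 \<and>
     gnorm (typeB_metric q) \<xi> = gnorm (typeB_metric q) (gradient typeB_metric (\<lambda>p. p $ c) q)"
  \<comment> \<open>The gradient is a positive multiple of e_c. For \<open>c\<close> other than 2, a
    nonzero symbol with upper index \<open>c\<close> has exactly one lower index equal to
    \<open>c\<close>, so the Hessian vanishes both on multiples of e_c and on vectors with
    \<open>c\<close>-th coordinate 0.\<close>
  then have "\<xi> $ c = 0"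
    using q exhaust_4[of c] by (auto simp: ginner_def grad inner_vec_def matrix_vector_mult_def
       sum_4 typeB_metric_nth matrix_inv_typeB_metric_nth axis_def)
  then show "hessian typeB_metric (\<lambda>p. p $ c) q (gradient typeB_metric (\<lambda>p. p $ c) q)
         (gradient typeB_metric (\<lambda>p. p $ c) q) + hessian typeB_metric (\<lambda>p. p $ c) q \<xi> \<xi> = 0"
    using assms(2) q exhaust_4[of c]
    by (auto simp: hessian_coord grad sum_4 christoffel_typeB_metric axis_def)
qed

lemma not_limiting_carleman_weight_typeB_metric:
  assumes "U \<subseteq> {q. q $ 2 > 0}" "U \<noteq> {}"
  shows "\<not> limiting_carleman_weight U typeB_metric (\<lambda>q. q $ 2)"
proof
  assume L: "limiting_carleman_weight U typeB_metric (\<lambda>q. q $ 2)"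
  obtain q where "q \<in> U" using assms by auto
  then have q: "q $ 2 > 0" using assms by auto
  note grad = gradient_coord_typeB_metric[OF q]
  \<comment> \<open>Since g_33 = x, this normalization gives \<open>\<xi>\<close> length 1, the
    length of the gradient of x. The Hessian there is 1/2, from the symbol with \<open>k = 2\<close>
    and \<open>i = j = 3\<close>, divided by x.\<close>
  define \<xi> :: "real^4" where "\<xi> = axis 3 (1 / sqrt (q $ 2))"
  let ?v = "gradient typeB_metric (\<lambda>p. p $ 2) q"
  have "ginner (typeB_metric q) \<xi> ?v = 0" "gnorm (typeB_metric q) \<xi> = gnorm (typeB_metric q) ?v"
    using q by (simp_all add: gnorm_def ginner_def grad inner_vec_def matrix_vector_mult_def
       sum_4 typeB_metric_nth matrix_inv_typeB_metric_nth axis_def \<xi>_def)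
  with L \<open>q \<in> U\<close> have "hessian typeB_metric (\<lambda>p. p $ 2) q ?v ?v + hessian typeB_metric (\<lambda>p. p $ 2) q \<xi> \<xi> = 0"
    unfolding limiting_carleman_weight_def by blast
  moreover have "hessian typeB_metric (\<lambda>p. p $ 2) q ?v ?v + hessian typeB_metric (\<lambda>p. p $ 2) q \<xi> \<xi>
     = 1 / (2 * q $ 2)"
    using q by (simp add: hessian_coord grad sum_4 christoffel_typeB_metric axis_def \<xi>_def)
  ultimately show False using q by simp
qed

theorem theorem6p1:
  fixes U :: "(real^4) set"
  assumes "open U" and "U \<subseteq> {q. q $ 2 > 0}" and "U \<noteq> {}"
  shows "(\<forall>q\<in>U. type_B (typeB_metric q) (weyl_operator typeB_metric q)) \<and>
         (\<forall>q\<in>U. {L. eigenflag_direction (typeB_metric q) (weyl_operator typeB_metric q) L} =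
                 {span {axis 1 1}, span {axis 2 1}, span {axis 3 1}, span {axis 4 1}}) \<and>
         limiting_carleman_weight U typeB_metric (\<lambda>q. q $ 1) \<and>
         limiting_carleman_weight U typeB_metric (\<lambda>q. q $ 3) \<and>
         limiting_carleman_weight U typeB_metric (\<lambda>q. q $ 4) \<and>
         \<not> limiting_carleman_weight U typeB_metric (\<lambda>q. q $ 2)"
proof -
  let ?W = "weyl_operator typeB_metric"
  have eigenflags: "{L. eigenflag_direction (typeB_metric q) (?W q) L} =
      {span {axis 1 1}, span {axis 2 1}, span {axis 3 1}, span {axis 4 1}}"
    and type_B: "type_B (typeB_metric q) (?W q)" if "q \<in> U" for q
  proof -
    have q: "q $ 2 > 0" using that assms(2) by auto
    let ?a = "- 5 / (24 * (q $ 2)\<^sup>2)" and ?b = "1 / (24 * (q $ 2)\<^sup>2)" and ?c = "1 / (6 * (q $ 2)\<^sup>2)"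
    have abc: "distinct [?a, ?b, ?c]"
      using q by (simp add: divide_simps)
    have "{L. eigenflag_direction (typeB_metric q) (?W q) L} = range (\<lambda>i. span {axis i 1})"
    proof (rule eigenflag_directions_eq_axes[where m = "pair_weight ?a ?b ?c"])
      show "ginner (typeB_metric q) v v > 0" if "v \<noteq> 0" for v
        using riemannian_metric_typeB_metric q that
        by (auto simp: riemannian_metric_on_def ginner_def)
    qed (fact weyl_operator_typeB_metric[OF q] pair_weight_commute pair_weight_separates[OF abc]
        | simp add: typeB_metric_nth)+
    then show "{L. eigenflag_direction (typeB_metric q) (?W q) L} =
        {span {axis 1 1}, span {axis 2 1}, span {axis 3 1}, span {axis 4 1}}"
      by (simp add: UNIV_4)
    then have "\<exists>L. eigenflag_direction (typeB_metric q) (?W q) L"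
      by blast
    with weyl_operator_typeB_metric[OF q] abc show "type_B (typeB_metric q) (?W q)"
      by (rule type_B_pair_weight)
  qed
  show ?thesis
    using eigenflags type_B limiting_carleman_weight_coord_typeB_metric[OF assms(2)]
      not_limiting_carleman_weight_typeB_metric[OF assms(2,3)]
    by simp
qed

end
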